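(* Let $X=X(\Sigma)$ be a $\mathbb{Q}$-factorial complete $n$-dimensional toric variety of rank $r$, and let $V$ be a (reduced) fan matrix of $\Sigma$. Then the following are equivalent: 1. the group $N/N_{\Sigma(1)}$ is trivial; 2. the Hermite normal form of the transposed matrix $V^T$ is $\begin{pmatrix}\mathbf I_n\\ \mathbf 0_{r,n}\end{pmatrix}$; 3. the lattice $\mathcal L_c(V)$ spanned by the columns of $V$ coincides with the whole $\mathbb Z^n$; 4. the $n\times n$ minors of $V$ are coprime (their greatest common divisor is $1$).
   Context: $N$ is a lattice of rank $n$ (identified with $\mathbb Z^n$ by choosing a basis), and $\Sigma$ is a fan of rational strictly convex cones in $N\otimes\mathbb R$. $X(\Sigma)$ is the associated normal toric variety over $\mathbb C$; $\mathbb Q$-factorial and complete means that every cone of $\Sigma$ is simplicial and that the union of the cones is $N\otimes\mathbb R$. $\Sigma(1)$ is the set of rays; the rank of $X$ is $r=\mathrm{rk}\,\mathrm{Pic}(X)\ge 1$, and $|\Sigma(1)|=n+r$. For a ray $\rho$, $\mathbf v_\rho$ is the generator of the monoid $\rho\cap N$, and $N_{\Sigma(1)}\subseteq N$ is the subgroup generated by all $\mathbf v_\rho$, $\rho\in\Sigma(1)$. A (reduced) fan matrix of $\Sigma$ is the $n\times(n+r)$ integer matrix $V$ whose columns are the vectors $\mathbf v_\rho$, in some order. $\mathbf I_n$ is the identity matrix and $\mathbf 0_{r,n}$ the $r\times n$ zero matrix. Hermite normal form: an integer $p\times q$ matrix $(m_{ij})$ is in Hermite normal form (HNF) if there are $s\le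 p$ and a strictly increasing map $f:\{1,\dots,s\}\to\{1,\dots,q\}$ such that for $1\le i\le s$: $m_{i,f(i)}\ge1$, $m_{ij}=0$ if $j<f(i)$, and $0\le m_{i,f(k)}<m_{k,f(k)}$ if $i<k\leq s$; and the last $p-s$ rows are zero. For every integer $p\times q$ matrix $A$ there is a unique matrix $B$ in HNF of the form $B=UA$ with $U\in \mathrm{GL}_p(\mathbb Z)$; $B$ is the HNF of $A$. *)

theory Defs
  imports
    "HOL-Algebra.Elementary_Groups"
    "HOL-Algebra.Generated_Groups"
    "Jordan_Normal_Form.Determinant"
    "Jordan_Normal_Form.DL_Submatrix"
    "Jordan_Normal_Form.VS_Connect"
begin

section \<open>Rational polyhedral cones and fans\<close>

text \<open>The lattice $N$ is $\mathbb{Z}^n$, the set of integer vectors of dimension \<open>n\<close>, and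
  $N \otimes \mathbb{R}$ is the set of real vectors of dimension \<open>n\<close>.\<close>

abbreviation real_vec :: "int vec \<Rightarrow> real vec" where
  "real_vec \<equiv> map_vec real_of_int"

definition cone_of :: "nat \<Rightarrow> int vec set \<Rightarrow> real vec set" where
  "cone_of n S = {vec n (\<lambda>i. \<Sum>s\<in>S. c s * real_of_int (s $ i)) | c. \<forall>s\<in>S. 0 \<le> c s}"

definition rational_cone :: "nat \<Rightarrow> real vec set \<Rightarrow> bool" where
  "rational_cone n \<sigma> \<longleftrightarrow> (\<exists>S. finite S \<and> S \<subseteq> carrier_vec n \<and> \<sigma> = cone_of n S)"

definition strictly_convex_cone :: "nat \<Rightarrow> real vec set \<Rightarrow> bool" where
  "strictly_convex_cone n \<sigma> \<longleftrightarrow> \<sigma> \<inter> uminus ` \<sigma> = {0\<^sub>v n}"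

definition simplicial_cone :: "nat \<Rightarrow> real vec set \<Rightarrow> bool" where
  "simplicial_cone n \<sigma> \<longleftrightarrow>
     (\<exists>S. finite S \<and> S \<subseteq> carrier_vec n \<and> \<sigma> = cone_of n S \<and>
          \<not> module.lin_dep class_ring (module_vec TYPE(real) n) (real_vec ` S))"

text \<open>Faces are cut out by linear forms that are nonnegative on the cone; the form \<open>0\<close>
  gives the cone itself.\<close>

definition cone_face :: "nat \<Rightarrow> real vec set \<Rightarrow> real vec set \<Rightarrow> bool" where
  "cone_face n \<tau> \<sigma> \<longleftrightarrow>
     (\<exists>u\<in>carrier_vec n. (\<forall>x\<in>\<sigma>. 0 \<le> u \<bullet> x) \<and> \<tau> = {x\<in>\<sigma>. u \<bullet> x = 0})"

definition fan :: "nat \<Rightarrow> real vec set set \<Rightarrow> bool" where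
  "fan n \<Sigma> \<longleftrightarrow> finite \<Sigma> \<and> \<Sigma> \<noteq> {} \<and>
     (\<forall>\<sigma>\<in>\<Sigma>. rational_cone n \<sigma> \<and> strictly_convex_cone n \<sigma>) \<and>
     (\<forall>\<sigma>\<in>\<Sigma>. \<forall>\<tau>. cone_face n \<tau> \<sigma> \<longrightarrow> \<tau> \<in> \<Sigma>) \<and>
     (\<forall>\<sigma>\<in>\<Sigma>. \<forall>\<tau>\<in>\<Sigma>. cone_face n (\<sigma> \<inter> \<tau>) \<sigma> \<and> cone_face n (\<sigma> \<inter> \<tau>) \<tau>)"

text \<open>The toric variety $X(\Sigma)$ is $\mathbb{Q}$-factorial iff its fan is simplicial, and
  complete iff the cones cover $N \otimes \mathbb{R}$.\<close>

definition simplicial_fan :: "nat \<Rightarrow> real vec set set \<Rightarrow> bool" where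
  "simplicial_fan n \<Sigma> \<longleftrightarrow> (\<forall>\<sigma>\<in>\<Sigma>. simplicial_cone n \<sigma>)"

definition complete_fan :: "nat \<Rightarrow> real vec set set \<Rightarrow> bool" where
  "complete_fan n \<Sigma> \<longleftrightarrow> \<Union>\<Sigma> = carrier_vec n"


section \<open>Rays and the fan matrix\<close>

definition rays :: "nat \<Rightarrow> real vec set set \<Rightarrow> real vec set set" where
  "rays n \<Sigma> = {\<rho>\<in>\<Sigma>. \<exists>v\<in>carrier_vec n. v \<noteq> 0\<^sub>v n \<and> \<rho> = cone_of n {v}}"

definition lattice_points :: "nat \<Rightarrow> real vec set \<Rightarrow> int vec set" where
  "lattice_points n \<sigma> = {v\<in>carrier_vec n. real_vec v \<in> \<sigma>}"

definition ray_generator :: "nat \<Rightarrow> real vec set \<Rightarrow> int vec" where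
  "ray_generator n \<rho> =
     (THE v. v \<in> carrier_vec n \<and> lattice_points n \<rho> = {int k \<cdot>\<^sub>v v | k. True})"

definition ray_lattice :: "nat \<Rightarrow> real vec set set \<Rightarrow> int vec set" where
  "ray_lattice n \<Sigma> = generate (monoid_vec TYPE(int) n) (ray_generator n ` rays n \<Sigma>)"

definition fan_matrix :: "nat \<Rightarrow> real vec set set \<Rightarrow> int mat \<Rightarrow> bool" where
  "fan_matrix n \<Sigma> V \<longleftrightarrow> V \<in> carrier_mat n (card (rays n \<Sigma>)) \<and>
     (\<exists>\<rho>. bij_betw \<rho> {..<dim_col V} (rays n \<Sigma>) \<and>
          (\<forall>j<dim_col V. col V j = ray_generator n (\<rho> j)))"


section \<open>Integer matrices\<close>

text \<open>Row and column indices start at \<open>0\<close>.  The first \<open>s\<close> rows are the nonzero ones, and the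
  pivot of row \<open>i\<close> is in column \<open>f i\<close>.\<close>

definition hermite_normal_form :: "int mat \<Rightarrow> bool" where
  "hermite_normal_form M \<longleftrightarrow>
     (\<exists>s f. s \<le> dim_row M \<and> strict_mono_on {..<s} f \<and> f ` {..<s} \<subseteq> {..<dim_col M} \<and>
        (\<forall>i<s. 1 \<le> M $$ (i, f i) \<and>
               (\<forall>j<f i. M $$ (i, j) = 0) \<and>
               (\<forall>k. i < k \<and> k < s \<longrightarrow>
                    0 \<le> M $$ (i, f k) \<and> M $$ (i, f k) < M $$ (k, f k))) \<and>
        (\<forall>i. s \<le> i \<and> i < dim_row M \<longrightarrow> (\<forall>j<dim_col M. M $$ (i, j) = 0)))"

text \<open>A relation between \<open>A\<close> and \<open>B\<close>; every \<open>A\<close> has exactly one such \<open>B\<close>.\<close>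

definition is_hnf_of :: "int mat \<Rightarrow> int mat \<Rightarrow> bool" where
  "is_hnf_of B A \<longleftrightarrow> hermite_normal_form B \<and>
     (\<exists>U\<in>carrier_mat (dim_row A) (dim_row A). invertible_mat U \<and> B = U * A)"

definition column_lattice :: "int mat \<Rightarrow> int vec set" where
  "column_lattice A = {A *\<^sub>v x | x. x \<in> carrier_vec (dim_col A)}"

definition minors :: "nat \<Rightarrow> int mat \<Rightarrow> int set" where
  "minors k A = {det (submatrix A I J) | I J.
     I \<subseteq> {..<dim_row A} \<and> J \<subseteq> {..<dim_col A} \<and> card I = k \<and> card J = k}"

end

theory Submission
  imports Defs
begin

text \<open>The vectors $\mathbf{v}_\rho$ are the columns of $V$, so the subgroup they generate is
  the column lattice $L$ of $V$ (\<open>ray_lattice_eq_column_lattice\<close>), and $N/L$ is trivial iff $L$ is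
  all of $\mathbb{Z}^n$.  The rest is linear algebra over $\mathbb{Z}$.  The key observation is
  that $L = \mathbb{Z}^n$ iff $V^T$ has an integer left inverse $X$: the $i$-th row of $X$ is
  a preimage of the $i$-th unit vector under $V$.

  Hermite normal form.  If $U V^T$ consists of $\mathbf{I}_n$ above zero rows, the first $n$ rows
  of $U$ form a left inverse of $V^T$.  For the converse, Euclid's algorithm with row operations
  brings $V^T$ to a triangular block $L_0$ above zero rows.  A left inverse of $V^T$ then gives
  one of $L_0$, and, $L_0$ being square, this makes $L_0$ unimodular: multiplying the first $n$
  rows by $L_0^{-1}$ finishes the reduction
  (\<open>left_invertible_row_equivalent\<close>).

  Minors.  If $X V^T = \mathbf{I}_n$, multilinearity of the determinant in the rows writes
  $1 = \det(X V^T)$ as an integer combination of determinants of $n$ columns of $V$, each of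
  which is $0$ or, up to sign, an $n \times n$ minor; hence the gcd of the minors divides $1$.
  This is the part of the Cauchy--Binet formula that matters here
  (\<open>Gcd_minors_dvd_det_mult\<close>).  Conversely, if $S$ is an $n \times n$ submatrix of $V$, then
  $\det(S)\, v = S\, \mathrm{adj}(S)\, v$ lies in $L$ for every $v$.  The integers
  $a$ with $a v \in L$ form an ideal containing all the minors, hence their gcd.\<close>


section \<open>Unimodular row operations\<close>

text \<open>From $AB = I$ one gets $\det A \det B = 1$, so $C = \det B \cdot \mathrm{adj}\,A$ is a left
  inverse of $A$, and a left inverse agrees with a right inverse.\<close>

lemma mat_left_inverse_of_right_inverse:
  fixes A B :: "'a :: comm_ring_1 mat"
  assumes A: "A \<in> carrier_mat n n" and B: "B \<in> carrier_mat n n" and AB: "A * B = 1\<^sub>m n"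
  shows "B * A = 1\<^sub>m n"
proof -
  define C where "C = det B \<cdot>\<^sub>m adj_mat A"
  have adj: "adj_mat A \<in> carrier_mat n n" by (rule adj_mat(1)[OF A])
  have C: "C \<in> carrier_mat n n" using adj by (simp add: C_def)
  have "det A * det B = 1" using det_mult[OF A B] AB by simp
  moreover have "C * A = det B \<cdot>\<^sub>m (det A \<cdot>\<^sub>m 1\<^sub>m n)"
    unfolding C_def adj_mat(3)[OF A, symmetric] by (rule mult_smult_assoc_mat[OF adj A])
  ultimately have CA: "C * A = 1\<^sub>m n"
    by (intro eq_matI) (auto simp: mult.commute)
  have "B = (C * A) * B" using B CA by simp
  also have "\<dots> = C * (A * B)" using A B C by (rule assoc_mult_mat[rotated])
  also have "\<dots> = C" using C AB by simp
  finally show ?thesis using CA by simp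
qed

lemma invertible_matI:
  assumes "A \<in> carrier_mat n n" and "B \<in> carrier_mat n n"
    and "A * B = 1\<^sub>m n" and "B * A = 1\<^sub>m n"
  shows "invertible_mat A"
  using assms unfolding invertible_mat_def inverts_mat_def by auto

lemma invertible_matE:
  assumes inv: "invertible_mat A" and A: "A \<in> carrier_mat n n"
  obtains B where "B \<in> carrier_mat n n" and "A * B = 1\<^sub>m n" and "B * A = 1\<^sub>m n"
proof -
  obtain B where AB: "A * B = 1\<^sub>m n" and BA: "B * A = 1\<^sub>m (dim_row B)"
    using inv A unfolding invertible_mat_def inverts_mat_def by auto
  have "dim_col B = n" using arg_cong[OF AB, of dim_col] by simp
  moreover have "dim_row B = n" using arg_cong[OF BA, of dim_col] A by simp
  ultimately show thesis using that AB BA by auto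
qed

lemma invertible_mat_mult:
  assumes A: "A \<in> carrier_mat n n" and B: "B \<in> carrier_mat n n"
    and "invertible_mat A" and "invertible_mat B"
  shows "invertible_mat (A * B)"
proof -
  obtain A' where A': "A' \<in> carrier_mat n n" "A * A' = 1\<^sub>m n" "A' * A = 1\<^sub>m n"
    using assms by (elim invertible_matE[of A n])
  obtain B' where B': "B' \<in> carrier_mat n n" "B * B' = 1\<^sub>m n" "B' * B = 1\<^sub>m n"
    using assms by (elim invertible_matE[of B n])
  have "B * (B' * A') = A'" and "A' * (A * B) = B"
    using assoc_mult_mat[OF B B'(1) A'(1)] assoc_mult_mat[OF A'(1) A B] A' B B'
    by (metis left_mult_one_mat)+
  hence "(A * B) * (B' * A') = 1\<^sub>m n" and "(B' * A') * (A * B) = 1\<^sub>m n"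
    using assoc_mult_mat[OF A B, of "B' * A'" n] assoc_mult_mat[OF B'(1) A'(1), of "A * B" n]
      A B A' B' by simp_all
  thus ?thesis
    using A B A' B' by (intro invertible_matI[of _ n "B' * A'"]) simp_all
qed

definition row_equivalent :: "'a :: comm_ring_1 mat \<Rightarrow> 'a mat \<Rightarrow> bool" where
  "row_equivalent A B \<longleftrightarrow>
     (\<exists>U\<in>carrier_mat (dim_row A) (dim_row A). invertible_mat U \<and> B = U * A)"

lemma row_equivalent_carrier:
  "row_equivalent A B \<Longrightarrow> A \<in> carrier_mat m n \<Longrightarrow> B \<in> carrier_mat m n"
  unfolding row_equivalent_def by auto

lemma row_equivalent_mult:
  "U \<in> carrier_mat m m \<Longrightarrow> invertible_mat U \<Longrightarrow> A \<in> carrier_mat m n \<Longrightarrow> row_equivalent A (U * A)"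
  unfolding row_equivalent_def by auto

lemma row_equivalent_refl: "row_equivalent A A"
  unfolding row_equivalent_def
  by (rule bexI[of _ "1\<^sub>m (dim_row A)"])
     (auto intro: invertible_matI[of _ "dim_row A" "1\<^sub>m (dim_row A)"])

lemma row_equivalent_trans:
  assumes "row_equivalent A B" and "row_equivalent B C"
  shows "row_equivalent A C"
proof -
  obtain U where U: "U \<in> carrier_mat (dim_row A) (dim_row A)" "invertible_mat U" "B = U * A"
    using assms unfolding row_equivalent_def by auto
  obtain W where W: "W \<in> carrier_mat (dim_row A) (dim_row A)" "invertible_mat W" "C = W * B"
    using assms U unfolding row_equivalent_def by auto
  have "C = (W * U) * A"
    unfolding W(3) U(3) using W(1) U(1) by (intro assoc_mult_mat[symmetric]) auto
  thus ?thesis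
    using U W invertible_mat_mult[of W "dim_row A" U] unfolding row_equivalent_def
    by (intro bexI[of _ "W * U"]) auto
qed

lemma row_equivalent_addrow:
  assumes A: "A \<in> carrier_mat m n" and kl: "k < m" "l < m" "k \<noteq> l"
  shows "row_equivalent A (addrow a k l A)"
  unfolding addrow_mat[OF A kl(2)]
proof (rule row_equivalent_mult[OF _ _ A])
  show "invertible_mat (addrow_mat m a k l)"
    using addrow_mat_inv[OF kl, of a] addrow_mat_inv[OF kl, of "- a"]
    by (intro invertible_matI[of _ m "addrow_mat m (- a) k l"]) auto
qed simp

lemma row_equivalent_swaprows:
  assumes A: "A \<in> carrier_mat m n" and kl: "k < m" "l < m"
  shows "row_equivalent A (swaprows k l A)"
  unfolding swaprows_mat[OF A kl]
proof (rule row_equivalent_mult[OF _ _ A])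
  show "invertible_mat (swaprows_mat m k l)"
    using swaprows_mat_inv[OF kl]
    by (intro invertible_matI[of _ m "swaprows_mat m k l"]) auto
qed simp


section \<open>Reduction to upper triangular form\<close>

text \<open>The first \<open>k\<close> columns vanish below the diagonal.  There is no condition on the other
  columns, so that the predicate can serve as the invariant of a column by column elimination,
  and \<open>A\<close> need not be square.\<close>

definition cleared :: "nat \<Rightarrow> 'a :: zero mat \<Rightarrow> bool" where
  "cleared k A \<longleftrightarrow> (\<forall>j<k. \<forall>i. j < i \<and> i < dim_row A \<longrightarrow> A $$ (i, j) = 0)"

text \<open>Euclid's algorithm on the entries of column \<open>k\<close> in the rows from \<open>k\<close> on: as long as two of
  them are nonzero, adding or subtracting the row of the smaller one lowers the sum of their
  absolute values.  The last nonzero entry is then swapped into row \<open>k\<close>.  Rows from \<open>k\<close> on are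
  zero in the earlier columns, so none of these operations disturbs what is already cleared.\<close>

lemma clear_next_column:
  fixes A :: "int mat"
  assumes "A \<in> carrier_mat m n" and "k < n" and "cleared k A"
  shows "\<exists>B. row_equivalent A B \<and> cleared (Suc k) B"
  using assms
proof (induction "\<Sum>i\<in>{k..<m}. nat \<bar>A $$ (i, k)\<bar>" arbitrary: A rule: less_induct)
  case less
  note A = less.prems(1) and k = less.prems(2) and cl = less.prems(3)
  have dims: "dim_row A = m" "dim_col A = n" using A by auto
  show ?case
  proof (cases "\<exists>p q. k \<le> p \<and> p < m \<and> k \<le> q \<and> q < m \<and> p \<noteq> q \<and> A $$ (p, k) \<noteq> 0
      \<and> \<bar>A $$ (p, k)\<bar> \<le> \<bar>A $$ (q, k)\<bar>")
    case True
    then obtain p q where pq: "k \<le> p" "p < m" "k \<le> q" "q < m" "p \<noteq> q" "A $$ (p, k) \<noteq> 0"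
      "\<bar>A $$ (p, k)\<bar> \<le> \<bar>A $$ (q, k)\<bar>" by blast
    \<comment> \<open>The sign is chosen so that the new entry has absolute value
      \<open>\<bar>A $$ (q, k)\<bar> - \<bar>A $$ (p, k)\<bar>\<close>.\<close>
    define a where "a = - (sgn (A $$ (p, k)) * sgn (A $$ (q, k)))"
    define B where "B = addrow a q p A"
    have AB: "row_equivalent A B"
      unfolding B_def using A pq by (intro row_equivalent_addrow) auto
    have B: "B \<in> carrier_mat m n" using row_equivalent_carrier[OF AB A] .
    have B_entry: "B $$ (i, j) = (if q = i then a * A $$ (p, j) + A $$ (q, j) else A $$ (i, j))"
      if "i < m" "j < n" for i j
      using that dims by (simp add: B_def)
    have cl': "cleared k B"
      using cl B pq k unfolding cleared_def by (auto simp: dims B_entry)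
    have "\<bar>B $$ (q, k)\<bar> < \<bar>A $$ (q, k)\<bar>"
      using pq k by (auto simp: B_entry a_def sgn_if abs_if split: if_splits)
    moreover have "\<bar>B $$ (i, k)\<bar> \<le> \<bar>A $$ (i, k)\<bar>" if "i < m" for i
      using that k calculation B_entry[of i k] by (cases "i = q") auto
    ultimately have "(\<Sum>i\<in>{k..<m}. nat \<bar>B $$ (i, k)\<bar>) < (\<Sum>i\<in>{k..<m}. nat \<bar>A $$ (i, k)\<bar>)"
      using pq by (intro sum_strict_mono_ex1) (auto intro!: nat_mono bexI[of _ q])
    from less.hyps[OF this B k cl'] obtain C where "row_equivalent B C" "cleared (Suc k) C"
      by blast
    thus ?thesis using row_equivalent_trans[OF AB] by blast
  next
    case False
    have unique: "p = q" if "k \<le> p" "p < m" "k \<le> q" "q < m" "A $$ (p, k) \<noteq> 0" "A $$ (q, k) \<noteq> 0"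
      for p q
      using False that le_cases[of "\<bar>A $$ (p, k)\<bar>" "\<bar>A $$ (q, k)\<bar>"] by blast
    show ?thesis
    proof (cases "\<exists>p. k \<le> p \<and> p < m \<and> A $$ (p, k) \<noteq> 0")
      case True
      then obtain p where p: "k \<le> p" "p < m" "A $$ (p, k) \<noteq> 0" by blast
      define B where "B = swaprows k p A"
      have AB: "row_equivalent A B"
        unfolding B_def using A p by (intro row_equivalent_swaprows) auto
      have B: "dim_row B = m" using row_equivalent_carrier[OF AB A] by simp
      have zero: "A $$ (i, k) = 0" if "k \<le> i" "i < m" "i \<noteq> p" for i
        using unique[of i p] that p by blast
      have "cleared (Suc k) B"
        unfolding cleared_def
      proof (intro allI impI)
        fix j i assume j: "j < Suc k" and i: "j < i \<and> i < dim_row B"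
        have Bij: "B $$ (i, j) = (if k = i then A $$ (p, j) else if p = i then A $$ (k, j) else A $$ (i, j))"
          using i j k by (simp add: B_def dims)
        show "B $$ (i, j) = 0"
          using cl zero[of i] zero[of k] i j p k unfolding Bij cleared_def B
          by (cases "j = k") (auto simp: dims)
      qed
      thus ?thesis using AB by blast
    next
      case False
      hence "cleared (Suc k) A"
        using cl unfolding cleared_def dims by (auto simp: less_Suc_eq)
      thus ?thesis using row_equivalent_refl by blast
    qed
  qed
qed

lemma row_equivalent_upper_triangular:
  fixes A :: "int mat"
  assumes A: "A \<in> carrier_mat m n" and "k \<le> n"
  shows "\<exists>B. row_equivalent A B \<and> cleared k B"
  using \<open>k \<le> n\<close>
proof (induction k)
  case 0
  show ?case by (auto simp: cleared_def intro: row_equivalent_refl)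
next
  case (Suc k)
  then obtain B where B: "row_equivalent A B" "cleared k B" by auto
  with clear_next_column[OF row_equivalent_carrier[OF B(1) A] _ B(2)] Suc.prems
  show ?case using row_equivalent_trans[OF B(1)] by (metis Suc_le_lessD)
qed

text \<open>Being left invertible survives row equivalence, and for a matrix with only zeros below its
  top square block it says that this block is left invertible, hence unimodular.  Undoing the
  block then leaves the identity.\<close>

lemma left_invertible_row_equivalent:
  fixes A :: "int mat"
  assumes A: "A \<in> carrier_mat (n + r) n" and X: "X \<in> carrier_mat n (n + r)"
    and XA: "X * A = 1\<^sub>m n"
  shows "row_equivalent A (1\<^sub>m n @\<^sub>r 0\<^sub>m r n)"
proof -
  obtain B where AB: "row_equivalent A B" and cl: "cleared n B"
    using row_equivalent_upper_triangular[OF A order.refl] by blast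
  have B: "B \<in> carrier_mat (n + r) n" using row_equivalent_carrier[OF AB A] .
  obtain U where U: "U \<in> carrier_mat (n + r) (n + r)" "invertible_mat U" and BU: "B = U * A"
    using AB A unfolding row_equivalent_def by auto
  obtain W where W: "W \<in> carrier_mat (n + r) (n + r)" and WU: "W * U = 1\<^sub>m (n + r)"
    using invertible_matE[OF U(2,1)] by metis
  \<comment> \<open>\<open>Y\<close> is the left inverse of \<open>B = U * A\<close> obtained by transporting \<open>X\<close>.\<close>
  define Y where "Y = X * W"
  have Y: "Y \<in> carrier_mat n (n + r)" using X W by (simp add: Y_def)
  have "Y * B = X * ((W * U) * A)"
    using X W U A unfolding Y_def BU by (simp add: assoc_mult_mat[of _ _ "n + r" _ "n + r" _ n])
  hence YB: "Y * B = 1\<^sub>m n" using A XA WU by simp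
  define L where "L = mat n n (\<lambda>(i, j). B $$ (i, j))"
  define M where "M = mat n n (\<lambda>(i, j). Y $$ (i, j))"
  have L: "L \<in> carrier_mat n n" and M: "M \<in> carrier_mat n n" by (auto simp: L_def M_def)
  have low: "B $$ (i, j) = 0" if "n \<le> i" "i < n + r" "j < n" for i j
    using cl that B unfolding cleared_def by auto
  have BL: "B = L @\<^sub>r 0\<^sub>m r n"
    using B low by (intro eq_matI) (auto simp: append_rows_def L_def)
  have M_L: "M * L = 1\<^sub>m n"
  proof (rule eq_matI)
    fix i j assume "i < dim_row (1\<^sub>m n :: int mat)" "j < dim_col (1\<^sub>m n :: int mat)"
    hence ij: "i < n" "j < n" by auto
    have "(\<Sum>k = 0..<n + r. Y $$ (i, k) * B $$ (k, j)) = (\<Sum>k = 0..<n. Y $$ (i, k) * B $$ (k, j))"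
      using low ij by (intro sum.mono_neutral_right) auto
    hence "(M * L) $$ (i, j) = (Y * B) $$ (i, j)"
      using ij Y B L M by (simp add: scalar_prod_def) (simp add: L_def M_def)
    thus "(M * L) $$ (i, j) = 1\<^sub>m n $$ (i, j)" using YB by simp
  qed (use L M in auto)
  have L_M: "L * M = 1\<^sub>m n" by (rule mat_left_inverse_of_right_inverse[OF M L M_L])
  let ?D = "\<lambda>K. four_block_mat K (0\<^sub>m n r) (0\<^sub>m r n) (1\<^sub>m r :: int mat)"
  have D_mult: "?D K * ?D K' = ?D (K * K')" if "K \<in> carrier_mat n n" "K' \<in> carrier_mat n n" for K K'
    using that by (subst mult_four_block_mat[of _ n n _ r _ r _ _ n _ r]) auto
  have one: "?D (1\<^sub>m n) = 1\<^sub>m (n + r)" by (intro eq_matI) auto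
  have "invertible_mat (?D M)"
    using D_mult[OF M L] D_mult[OF L M] M_L L_M L M one
    by (intro invertible_matI[of _ "n + r" "?D L"]) auto
  hence "row_equivalent B (?D M * B)"
    using M B by (intro row_equivalent_mult[of _ "n + r"]) auto
  moreover have "?D M * B = 1\<^sub>m n @\<^sub>r 0\<^sub>m r n"
    unfolding BL append_rows_def using L M M_L
    by (subst mult_four_block_mat[of _ n n _ r _ r _ _ n _ 0]) auto
  ultimately show ?thesis using row_equivalent_trans[OF AB] by simp
qed

lemma hermite_normal_form_identity_block: "hermite_normal_form (1\<^sub>m n @\<^sub>r 0\<^sub>m r n)"
  unfolding hermite_normal_form_def
  by (rule exI[of _ n], rule exI[of _ "\<lambda>i. i"]) (auto simp: append_rows_def strict_mono_on_def)

text \<open>In the easy direction the left inverse is the top \<open>n\<close> rows of the transforming matrix,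
  since those rows produce the identity block.\<close>

lemma is_hnf_of_identity_block_iff:
  assumes A: "A \<in> carrier_mat (n + r) n"
  shows "is_hnf_of (1\<^sub>m n @\<^sub>r 0\<^sub>m r n) A
    \<longleftrightarrow> (\<exists>X\<in>carrier_mat n (n + r). X * A = 1\<^sub>m n)"
proof
  assume "is_hnf_of (1\<^sub>m n @\<^sub>r 0\<^sub>m r n) A"
  then obtain U where U: "U \<in> carrier_mat (n + r) (n + r)" and UA: "1\<^sub>m n @\<^sub>r 0\<^sub>m r n = U * A"
    using A unfolding is_hnf_of_def by auto
  define X where "X = mat n (n + r) (\<lambda>(i, j). U $$ (i, j))"
  have "X * A = 1\<^sub>m n"
  proof (rule eq_matI)
    fix i j assume "i < dim_row (1\<^sub>m n :: int mat)" "j < dim_col (1\<^sub>m n :: int mat)"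
    hence ij: "i < n" "j < n" by auto
    have "(X * A) $$ (i, j) = (U * A) $$ (i, j)"
      using ij A U by (simp add: X_def scalar_prod_def)
    thus "(X * A) $$ (i, j) = 1\<^sub>m n $$ (i, j)"
      using ij unfolding UA[symmetric] by (simp add: append_rows_def)
  qed (use A in \<open>auto simp: X_def\<close>)
  thus "\<exists>X\<in>carrier_mat n (n + r). X * A = 1\<^sub>m n"
    by (intro bexI[of _ X]) (auto simp: X_def)
next
  assume "\<exists>X\<in>carrier_mat n (n + r). X * A = 1\<^sub>m n"
  thus "is_hnf_of (1\<^sub>m n @\<^sub>r 0\<^sub>m r n) A"
    using left_invertible_row_equivalent[OF A] hermite_normal_form_identity_block
    unfolding is_hnf_of_def row_equivalent_def by blast
qed


section \<open>Column lattices\<close>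

text \<open>A preimage of each unit vector under \<open>V\<close>, taken as a row of \<open>X\<close>, gives
  \<open>V * X\<^sup>T = 1\<close>; conversely \<open>v = V * (X\<^sup>T * v)\<close>.  The identity is stated in
  transposed form because the Hermite normal form is that of \<open>V\<^sup>T\<close>.\<close>

lemma column_lattice_eq_carrier_iff:
  assumes V: "V \<in> carrier_mat n m"
  shows "column_lattice V = carrier_vec n
    \<longleftrightarrow> (\<exists>X\<in>carrier_mat n m. X * transpose_mat V = 1\<^sub>m n)"
proof
  assume full: "column_lattice V = carrier_vec n"
  have "\<exists>x. x \<in> carrier_vec m \<and> V *\<^sub>v x = unit_vec n i" if "i < n" for i
  proof -
    have "unit_vec n i \<in> column_lattice V" by (simp add: full)
    thus ?thesis using V unfolding column_lattice_def by auto
  qed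
  then obtain x where x: "\<And>i. i < n \<Longrightarrow> x i \<in> carrier_vec m"
      "\<And>i. i < n \<Longrightarrow> V *\<^sub>v x i = unit_vec n i"
    by metis
  define X where "X = mat\<^sub>r n m x"
  have "X * transpose_mat V = 1\<^sub>m n"
  proof (rule eq_matI)
    fix i j assume "i < dim_row (1\<^sub>m n :: int mat)" "j < dim_col (1\<^sub>m n :: int mat)"
    hence ij: "i < n" "j < n" by auto
    have "(X * transpose_mat V) $$ (i, j) = x i \<bullet> row V j"
      using ij V x(1)[OF ij(1)] by (simp add: X_def)
    also have "\<dots> = (V *\<^sub>v x i) $ j"
      using ij V x(1)[OF ij(1)] by (simp add: comm_scalar_prod[of _ m])
    finally show "(X * transpose_mat V) $$ (i, j) = 1\<^sub>m n $$ (i, j)"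
      using ij x(2)[OF ij(1)] by (simp add: unit_vec_def)
  qed (use V in \<open>auto simp: X_def\<close>)
  thus "\<exists>X\<in>carrier_mat n m. X * transpose_mat V = 1\<^sub>m n"
    by (intro bexI[of _ X]) (auto simp: X_def)
next
  assume "\<exists>X\<in>carrier_mat n m. X * transpose_mat V = 1\<^sub>m n"
  then obtain X where X: "X \<in> carrier_mat n m" and XV: "X * transpose_mat V = 1\<^sub>m n" by blast
  have VX: "V * transpose_mat X = 1\<^sub>m n"
    using arg_cong[OF XV, of transpose_mat] transpose_mult[OF X, of "transpose_mat V" n] V by simp
  show "column_lattice V = carrier_vec n"
  proof
    show "column_lattice V \<subseteq> carrier_vec n" using V unfolding column_lattice_def by auto
    show "carrier_vec n \<subseteq> column_lattice V"
    proof
      fix v :: "int vec" assume v: "v \<in> carrier_vec n"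
      have "V *\<^sub>v (transpose_mat X *\<^sub>v v) = (V * transpose_mat X) *\<^sub>v v"
        using V X v by (intro assoc_mult_mat_vec[symmetric]) auto
      hence "v = V *\<^sub>v (transpose_mat X *\<^sub>v v)" using VX v by simp
      moreover have "transpose_mat X *\<^sub>v v \<in> carrier_vec (dim_col V)" using V X v by auto
      ultimately show "v \<in> column_lattice V" unfolding column_lattice_def by blast
    qed
  qed
qed

lemma column_lattice_subgroup:
  assumes V: "V \<in> carrier_mat n m"
  shows "subgroup (column_lattice V) (monoid_vec TYPE(int) n)"
proof -
  interpret comm_group "monoid_vec TYPE(int) n" by (rule comm_group_vec)
  show ?thesis
  proof (rule subgroupI)
    show "column_lattice V \<subseteq> carrier (monoid_vec TYPE(int) n)"
      using V unfolding column_lattice_def by (auto simp: monoid_vec_simps)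
    show "column_lattice V \<noteq> {}"
      unfolding column_lattice_def using zero_carrier_vec by blast
  next
    fix a assume "a \<in> column_lattice V"
    then obtain x where x: "x \<in> carrier_vec m" and a: "a = V *\<^sub>v x"
      using V unfolding column_lattice_def by auto
    have "V *\<^sub>v (- x) = - a"
      using V x unfolding a by (intro eq_vecI) (auto simp: scalar_prod_uminus_right)
    moreover have "inv\<^bsub>monoid_vec TYPE(int) n\<^esub> a = - a"
      using V x unfolding a by (intro inv_equality) (auto simp: monoid_vec_simps)
    ultimately show "inv\<^bsub>monoid_vec TYPE(int) n\<^esub> a \<in> column_lattice V"
      using V x unfolding column_lattice_def by (auto intro!: exI[of _ "- x"])
  next
    fix a b assume "a \<in> column_lattice V" "b \<in> column_lattice V"
    then obtain x y where x: "x \<in> carrier_vec m" "a = V *\<^sub>v x" and y: "y \<in> carrier_vec m" "b = V *\<^sub>v y"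
      using V unfolding column_lattice_def by auto
    have "a + b = V *\<^sub>v (x + y)"
      using mult_add_distrib_mat_vec[OF V x(1) y(1)] x y by simp
    thus "a \<otimes>\<^bsub>monoid_vec TYPE(int) n\<^esub> b \<in> column_lattice V"
      using V x y unfolding column_lattice_def
      by (auto simp: monoid_vec_simps intro!: exI[of _ "x + y"])
  qed
qed

lemma subgroup_vec_int_smult:
  assumes H: "subgroup H (monoid_vec TYPE(int) n)" and h: "h \<in> H"
  shows "a \<cdot>\<^sub>v h \<in> H"
proof -
  interpret comm_group "monoid_vec TYPE(int) n" by (rule comm_group_vec)
  have carr: "h \<in> carrier_vec n"
    using subgroup.subset[OF H] h by (auto simp: monoid_vec_simps)
  have nat: "int k \<cdot>\<^sub>v h \<in> H" for k
  proof (induction k)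
    case 0
    have "int 0 \<cdot>\<^sub>v h = 0\<^sub>v n" using carr by (intro eq_vecI) auto
    thus ?case using subgroup.one_closed[OF H] by (simp add: monoid_vec_simps)
  next
    case (Suc k)
    have "int (Suc k) \<cdot>\<^sub>v h = int k \<cdot>\<^sub>v h + h"
      by (intro eq_vecI) (auto simp: algebra_simps)
    thus ?case using subgroup.m_closed[OF H Suc.IH h] by (simp add: monoid_vec_simps)
  qed
  have neg: "- v \<in> H" if v: "v \<in> H" for v
  proof -
    have "v \<in> carrier_vec n" using subgroup.subset[OF H] v by (auto simp: monoid_vec_simps)
    hence "inv\<^bsub>monoid_vec TYPE(int) n\<^esub> v = - v"
      by (intro inv_equality) (auto simp: monoid_vec_simps)
    thus ?thesis using subgroup.m_inv_closed[OF H v] by simp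
  qed
  show ?thesis
  proof (cases "0 \<le> a")
    case True
    thus ?thesis using nat[of "nat a"] by simp
  next
    case False
    have "a \<cdot>\<^sub>v h = - (int (nat (- a)) \<cdot>\<^sub>v h)" using False by (intro eq_vecI) auto
    thus ?thesis using neg[OF nat[of "nat (- a)"]] by simp
  qed
qed

text \<open>The generated subgroup is contained in the lattice because the columns are; conversely a
  combination of the columns is reached by adding its terms one at a time.\<close>

lemma generate_cols_eq_column_lattice:
  assumes V: "V \<in> carrier_mat n m"
  shows "generate (monoid_vec TYPE(int) n) (col V ` {..<m}) = column_lattice V"
    (is "?H = _")
proof
  interpret comm_group "monoid_vec TYPE(int) n" by (rule comm_group_vec)
  have "col V j \<in> column_lattice V" if "j < m" for j
  proof -
    have "V *\<^sub>v unit_vec m j = col V j"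
      using V that by (intro eq_vecI) auto
    moreover have "unit_vec m j \<in> carrier_vec (dim_col V)" using V by auto
    ultimately show ?thesis unfolding column_lattice_def by (metis (mono_tags, lifting) CollectI)
  qed
  thus "?H \<subseteq> column_lattice V"
    by (intro generate_subgroup_incl column_lattice_subgroup[OF V]) auto
  have H: "subgroup ?H (monoid_vec TYPE(int) n)"
    using V by (intro generate_is_subgroup) (auto simp: monoid_vec_simps)
  show "column_lattice V \<subseteq> ?H"
  proof
    fix v assume "v \<in> column_lattice V"
    then obtain x where x: "x \<in> carrier_vec m" and v: "v = V *\<^sub>v x"
      using V unfolding column_lattice_def by auto
    have "vec n (\<lambda>i. \<Sum>k<j. V $$ (i, k) * x $ k) \<in> ?H" if "j \<le> m" for j
      using that
    proof (induction j)
      case 0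
      have "vec n (\<lambda>i. \<Sum>k<0. V $$ (i, k) * x $ k) = 0\<^sub>v n" by auto
      thus ?case using subgroup.one_closed[OF H] by (simp add: monoid_vec_simps)
    next
      case (Suc j)
      have "vec n (\<lambda>i. \<Sum>k<Suc j. V $$ (i, k) * x $ k)
          = vec n (\<lambda>i. \<Sum>k<j. V $$ (i, k) * x $ k) + x $ j \<cdot>\<^sub>v col V j"
        using V Suc.prems by (intro eq_vecI) auto
      moreover have "x $ j \<cdot>\<^sub>v col V j \<in> ?H"
        using Suc.prems by (intro subgroup_vec_int_smult[OF H] generate.incl) auto
      ultimately show ?case
        using subgroup.m_closed[OF H] Suc by (simp add: monoid_vec_simps)
    qed
    moreover have "v = vec n (\<lambda>i. \<Sum>k<m. V $$ (i, k) * x $ k)"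
      using V x unfolding v by (intro eq_vecI) (auto simp: scalar_prod_def lessThan_atLeast0)
    ultimately show "v \<in> ?H" by simp
  qed
qed

lemma (in comm_group) trivial_group_Mod_iff:
  assumes H: "subgroup H G"
  shows "trivial_group (G Mod H) \<longleftrightarrow> H = carrier G"
proof -
  have "H \<lhd> G" using H by (rule normal_iff_subgroup[THEN iffD2])
  hence grp: "group (G Mod H)" by (rule normal.factorgroup_is_group)
  have "trivial_group (G Mod H) \<longleftrightarrow> (\<forall>x\<in>carrier G. H #> x = H)"
    unfolding trivial_group_def carrier_FactGroup using grp by auto
  also have "\<dots> \<longleftrightarrow> (\<forall>x\<in>carrier G. x \<in> H)"
    using coset_join1[OF _ _ H] coset_join2[OF _ H] by metis
  also have "\<dots> \<longleftrightarrow> H = carrier G" using subgroup.subset[OF H] by blast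
  finally show ?thesis .
qed


section \<open>Maximal minors\<close>

text \<open>By Bezout's identity, the gcd is an integer combination of the elements.\<close>

lemma Gcd_mem_int_ideal:
  fixes I S :: "int set"
  assumes "finite S" and "S \<subseteq> I" and "0 \<in> I"
    and "\<And>a b. a \<in> I \<Longrightarrow> b \<in> I \<Longrightarrow> a + b \<in> I" and "\<And>a c. a \<in> I \<Longrightarrow> c * a \<in> I"
  shows "Gcd S \<in> I"
  using assms(1,2)
proof (induction S)
  case empty
  thus ?case using assms(3) by simp
next
  case (insert a S)
  obtain u v where "u * a + v * Gcd S = gcd a (Gcd S)" using bezout_int by blast
  thus ?case using assms(4,5) insert by (metis Gcd_insert insert_subset)
qed

lemma submatrix_all_rows:
  assumes V: "V \<in> carrier_mat n m" and J: "J \<subseteq> {..<m}" "card J = n"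
  shows "submatrix V {..<n} J = mat n n (\<lambda>(i, j). V $$ (i, pick J j))"
proof -
  have pick_I: "pick {..<n} i = i" if "i < n" for i
    using pick_reduce_set[of i n UNIV] that by (simp add: pick_UNIV lessThan_def)
  have "{i. i < dim_row V \<and> i \<in> {..<n}} = {..<n}" and "{j. j < dim_col V \<and> j \<in> J} = J"
    using V J by auto
  thus ?thesis using J(2) unfolding submatrix_def by (intro eq_matI) (simp_all add: pick_I)
qed

text \<open>For a matrix with \<open>n\<close> rows, a minor of size \<open>n\<close> uses all rows.\<close>

lemma minors_eq:
  assumes V: "V \<in> carrier_mat n m"
  shows "minors n V = {det (submatrix V {..<n} J) | J. J \<subseteq> {..<m} \<and> card J = n}"
proof -
  have "I \<subseteq> {..<n} \<and> card I = n \<longleftrightarrow> I = {..<n}" for I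
    using card_subset_eq[of "{..<n}" I] by auto
  hence "I \<subseteq> {..<n} \<and> J \<subseteq> {..<m} \<and> card I = n \<and> card J = n
      \<longleftrightarrow> I = {..<n} \<and> J \<subseteq> {..<m} \<and> card J = n" for I J :: "nat set"
    by blast
  thus ?thesis using V unfolding minors_def by simp
qed

text \<open>Choose columns \<open>f 0, \<dots>, f (n - 1)\<close> of \<open>V\<close>, in any order and possibly with repetition.  A
  repetition makes the determinant \<open>0\<close>; otherwise sorting the columns turns it into a minor,
  up to the sign of the sorting permutation.\<close>

lemma Gcd_minors_dvd_det_rows:
  assumes V: "V \<in> carrier_mat n m" and f: "\<And>i. i < n \<Longrightarrow> f i < m"
  shows "Gcd (minors n V) dvd det (mat\<^sub>r n n (\<lambda>i. row (transpose_mat V) (f i)))"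
    (is "_ dvd det ?R")
proof -
  have R: "?R \<in> carrier_mat n n" by simp
  show ?thesis
  proof (cases "inj_on f {..<n}")
    case False
    then obtain i j where ij: "i < n" "j < n" "i \<noteq> j" "f i = f j" by (auto simp: inj_on_def)
    have "row ?R i = row ?R j" using ij V by simp
    hence "det ?R = 0" by (rule det_identical_rows[OF R ij(3,1,2)])
    thus ?thesis by simp
  next
    case True
    define J where "J = f ` {..<n}"
    have J: "J \<subseteq> {..<m}" "card J = n" using f True by (auto simp: J_def card_image)
    have fin: "finite J" by (simp add: J_def)
    define B where "B = transpose_mat (submatrix V {..<n} J)"
    have S: "submatrix V {..<n} J \<in> carrier_mat n n" by (simp add: submatrix_all_rows[OF V J])
    have B: "B \<in> carrier_mat n n" using S by (simp add: B_def)
    have B_entry: "B $$ (i, j) = V $$ (j, pick J i)" if "i < n" "j < n" for i j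
      using that by (simp add: B_def submatrix_all_rows[OF V J])
    \<comment> \<open>The rank of \<open>f i\<close> in \<open>J\<close>: column \<open>f i\<close> of \<open>V\<close> is column \<open>p i\<close> of the submatrix.\<close>
    define p where "p = (\<lambda>i. if i < n then card {a\<in>J. a < f i} else i)"
    have pick_p: "pick J (p i) = f i" if "i < n" for i
      using that by (simp add: p_def J_def pick_card_in_set)
    have p_less: "p i < n" if "i < n" for i
    proof -
      have "{a\<in>J. a < f i} \<subset> J" using that by (auto simp: J_def)
      thus ?thesis using psubset_card_mono[OF fin] J that by (simp add: p_def)
    qed
    have p: "p permutes {0..<n}"
    proof (rule inj_imp_permutes)
      show "inj_on p {0..<n}"
        using True pick_p by (metis (no_types, lifting) atLeastLessThan_iff inj_on_def lessThan_iff)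
    qed (auto simp: p_less, auto simp: p_def)
    have "?R = mat n n (\<lambda>(i, j). B $$ (p i, j))"
      using V f by (intro eq_matI) (auto simp: B_entry p_less pick_p)
    hence "det ?R = signof p * det B" using det_permute_rows[OF B p] by simp
    moreover have "det B \<in> minors n V"
      using J unfolding B_def det_transpose[OF S] minors_eq[OF V] by blast
    ultimately show ?thesis by (simp add: Gcd_dvd)
  qed
qed

text \<open>Row \<open>i\<close> of the product is the combination of the rows of \<open>V\<^sup>T\<close> with coefficients
  \<open>X $$ (i, k)\<close>.  Expanding the determinant in all rows gives a sum over the maps \<open>f\<close> that choose
  one \<open>k\<close> for each \<open>i\<close>.  Fixing \<open>f\<close> to be the identity outside the row indices makes this a
  finite sum in which each choice is counted once.\<close>

lemma Gcd_minors_dvd_det_mult: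
  assumes V: "V \<in> carrier_mat n m" and X: "X \<in> carrier_mat n m"
  shows "Gcd (minors n V) dvd det (X * transpose_mat V)"
proof -
  let ?A = "transpose_mat V"
  let ?F = "{f. (\<forall>i\<in>{0..<n}. f i \<in> {0..<m}) \<and> (\<forall>i. i \<notin> {0..<n} \<longrightarrow> f i = i)}"
  have A: "?A \<in> carrier_mat m n" using V by simp
  have "det (X * ?A)
      = (\<Sum>f\<in>?F. det (mat\<^sub>r n n (\<lambda>i. X $$ (i, f i) \<cdot>\<^sub>v row ?A (f i))))"
    unfolding mat_mul_finsum_alt[OF X A] using A by (intro det_linear_rows_sum) auto
  also have "\<dots> = (\<Sum>f\<in>?F. (\<Prod>i\<in>{0..<n}. X $$ (i, f i)) * det (mat\<^sub>r n n (\<lambda>i. row ?A (f i))))"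
    using A by (intro sum.cong refl det_rows_mul) auto
  also have "Gcd (minors n V) dvd \<dots>"
    by (intro dvd_sum dvd_mult Gcd_minors_dvd_det_rows[OF V]) auto
  finally show ?thesis .
qed

text \<open>With \<open>S\<close> the submatrix, \<open>det S \<cdot> v = S * (adj S * v)\<close> is an integer combination of the
  columns of \<open>S\<close>, which are columns of \<open>V\<close>.\<close>

lemma minor_smult_mem_column_lattice:
  assumes V: "V \<in> carrier_mat n m" and J: "J \<subseteq> {..<m}" "card J = n"
    and v: "v \<in> carrier_vec n"
  shows "det (submatrix V {..<n} J) \<cdot>\<^sub>v v \<in> column_lattice V"
proof -
  let ?S = "submatrix V {..<n} J"
  have S: "?S \<in> carrier_mat n n" by (simp add: submatrix_all_rows[OF V J])
  have fin: "finite J" using J(1) finite_subset by blast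
  have pick_less: "pick J k < m" if "k < n" for k
    using pick_in_set_le[of k J] that J by auto
  \<comment> \<open>The 0-1 matrix that selects the columns in \<open>J\<close>.\<close>
  define E where "E = mat m n (\<lambda>(j, k). if j = pick J k then 1 else 0 :: int)"
  have E: "E \<in> carrier_mat m n" by (simp add: E_def)
  have "?S = V * E"
  proof (rule eq_matI)
    fix i k assume "i < dim_row (V * E)" "k < dim_col (V * E)"
    hence ik: "i < n" "k < n" using V E by auto
    have "(V * E) $$ (i, k) = (\<Sum>j = 0..<m. V $$ (i, j) * (if j = pick J k then 1 else 0))"
      using ik V by (simp add: E_def scalar_prod_def)
    also have "\<dots> = V $$ (i, pick J k)"
      using pick_less[OF ik(2)] by (simp add: if_distrib[of "\<lambda>c. _ * c"] sum.delta' cong: if_cong)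
    finally show "?S $$ (i, k) = (V * E) $$ (i, k)"
      using ik by (simp add: submatrix_all_rows[OF V J])
  qed (use V E S in auto)
  have adj: "adj_mat ?S \<in> carrier_mat n n" by (rule adj_mat(1)[OF S])
  define w where "w = E *\<^sub>v (adj_mat ?S *\<^sub>v v)"
  have "V *\<^sub>v w = (V * E) *\<^sub>v (adj_mat ?S *\<^sub>v v)"
    unfolding w_def using V E adj v by (intro assoc_mult_mat_vec[symmetric]) auto
  also have "\<dots> = (?S * adj_mat ?S) *\<^sub>v v"
    unfolding \<open>?S = V * E\<close>[symmetric] using S adj v by (intro assoc_mult_mat_vec[symmetric]) auto
  also have "\<dots> = det ?S \<cdot>\<^sub>v v"
    unfolding adj_mat(2)[OF S] using v by (intro eq_vecI) auto
  finally have "det ?S \<cdot>\<^sub>v v = V *\<^sub>v w" ..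
  moreover have "w \<in> carrier_vec (dim_col V)" using V E adj v by (simp add: w_def)
  ultimately show ?thesis unfolding column_lattice_def by blast
qed

lemma column_lattice_eq_carrier_iff_Gcd_minors:
  assumes V: "V \<in> carrier_mat n m"
  shows "column_lattice V = carrier_vec n \<longleftrightarrow> Gcd (minors n V) = 1"
proof
  assume "column_lattice V = carrier_vec n"
  then obtain X where "X \<in> carrier_mat n m" and "X * transpose_mat V = 1\<^sub>m n"
    using column_lattice_eq_carrier_iff[OF V] by blast
  hence "Gcd (minors n V) dvd 1" using Gcd_minors_dvd_det_mult[OF V] by (metis det_one)
  thus "Gcd (minors n V) = 1"
    using zdvd1_eq by (metis Gcd_int_greater_eq_0 abs_of_nonneg)
next
  assume Gcd: "Gcd (minors n V) = 1"
  have sub: "column_lattice V \<subseteq> carrier_vec n"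
    using V unfolding column_lattice_def by auto
  have "v \<in> column_lattice V" if v: "v \<in> carrier_vec n" for v
  proof -
    \<comment> \<open>The annihilator ideal of the class of \<open>v\<close> modulo the column lattice.\<close>
    define I where "I = {a. a \<cdot>\<^sub>v v \<in> column_lattice V}"
    note H = column_lattice_subgroup[OF V]
    have "Gcd (minors n V) \<in> I"
    proof (rule Gcd_mem_int_ideal)
      have "finite {J. J \<subseteq> {..<m} \<and> card J = n}" by simp
      thus "finite (minors n V)" unfolding minors_eq[OF V] by (rule finite_image_set)
      show "minors n V \<subseteq> I"
        using minor_smult_mem_column_lattice[OF V _ _ v] unfolding minors_eq[OF V] I_def by auto
      have "0 \<cdot>\<^sub>v v = 0\<^sub>v n" using v by auto
      thus "0 \<in> I" using subgroup.one_closed[OF H] by (simp add: I_def monoid_vec_simps)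
    next
      fix a b assume "a \<in> I" "b \<in> I"
      thus "a + b \<in> I"
        using subgroup.m_closed[OF H] by (simp add: I_def monoid_vec_simps add_smult_distrib_vec)
    next
      fix a c assume "a \<in> I"
      thus "c * a \<in> I"
        using subgroup_vec_int_smult[OF H, of "a \<cdot>\<^sub>v v" c] by (simp add: I_def smult_smult_assoc)
    qed
    thus ?thesis using Gcd by (simp add: I_def)
  qed
  thus "column_lattice V = carrier_vec n" using sub by blast
qed


section \<open>Fan matrices\<close>

text \<open>The columns of \<open>V\<close> enumerate the ray generators, and having \<open>n\<close> rows already places them
  in $\mathbb{Z}^n$.\<close>

lemma ray_lattice_eq_column_lattice:
  assumes "fan_matrix n \<Sigma> V"
  shows "ray_lattice n \<Sigma> = column_lattice V"
proof -
  define m where "m = card (rays n \<Sigma>)"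
  have V: "V \<in> carrier_mat n m" using assms unfolding fan_matrix_def m_def by simp
  obtain \<rho> where \<rho>: "bij_betw \<rho> {..<m} (rays n \<Sigma>)"
      and col: "\<And>j. j < m \<Longrightarrow> col V j = ray_generator n (\<rho> j)"
    using assms V unfolding fan_matrix_def by auto
  have "ray_generator n ` rays n \<Sigma> = col V ` {..<m}"
    using col unfolding bij_betw_imp_surj_on[OF \<rho>, symmetric] image_image
    by (intro image_cong) auto
  thus ?thesis unfolding ray_lattice_def using generate_cols_eq_column_lattice[OF V] by simp
qed

theorem proposition2p6:
  fixes n r :: nat and \<Sigma> :: "real vec set set" and V :: "int mat"
  assumes "fan n \<Sigma>" and "simplicial_fan n \<Sigma>" and "complete_fan n \<Sigma>"
    and "1 \<le> r" and "card (rays n \<Sigma>) = n + r"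
    and "fan_matrix n \<Sigma> V"
  shows "(trivial_group (monoid_vec TYPE(int) n Mod ray_lattice n \<Sigma>)
            \<longleftrightarrow> is_hnf_of (1\<^sub>m n @\<^sub>r 0\<^sub>m r n) (transpose_mat V))
       \<and> (is_hnf_of (1\<^sub>m n @\<^sub>r 0\<^sub>m r n) (transpose_mat V)
            \<longleftrightarrow> column_lattice V = carrier_vec n)
       \<and> (column_lattice V = carrier_vec n \<longleftrightarrow> Gcd (minors n V) = 1)"
proof -
  have V: "V \<in> carrier_mat n (n + r)"
    using assms(5,6) unfolding fan_matrix_def by simp
  have "trivial_group (monoid_vec TYPE(int) n Mod ray_lattice n \<Sigma>)
      \<longleftrightarrow> column_lattice V = carrier_vec n"
    using comm_group.trivial_group_Mod_iff[OF comm_group_vec column_lattice_subgroup[OF V]]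
    by (simp add: ray_lattice_eq_column_lattice[OF assms(6)] monoid_vec_simps)
  moreover have "is_hnf_of (1\<^sub>m n @\<^sub>r 0\<^sub>m r n) (transpose_mat V)
      \<longleftrightarrow> column_lattice V = carrier_vec n"
    using is_hnf_of_identity_block_iff[of "transpose_mat V" n r]
      column_lattice_eq_carrier_iff[OF V] V by simp
  ultimately show ?thesis using column_lattice_eq_carrier_iff_Gcd_minors[OF V] by simp
qed

end
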